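(* Let $X$ be a spectrally negative L\'evy process with scale functions $W^{(\cdot)},Z^{(\cdot)}$, let $p,q>0$, $0<a<b$, and let $\omega(x)=p+q\mathbf{1}_{(a,b)}(x)$. Let $\mathcal{W}^{(\omega)},\mathcal{Z}^{(\omega)}$ be the associated $\omega$-scale functions. Then for all $x\ge0$, $$\mathcal{W}^{(\omega)}(x)=\mathcal{W}_a^{(p,q)}(x)-q\int_b^xW^{(p)}(x-z)\,\mathcal{W}_a^{(p,q)}(z)\,dz,$$ $$\mathcal{Z}^{(\omega)}(x)=\mathcal{Z}_a^{(p,q)}(x)-q\int_b^xW^{(p)}(x-z)\,\mathcal{Z}_a^{(p,q)}(z)\,dz,$$ where $$\mathcal{W}_a^{(p,q)}(x)=W^{(p)}(x)+q\int_a^xW^{(p+q)}(x-y)W^{(p)}(y)\,dy,\qquad \mathcal{Z}_a^{(p,q)}(x)=Z^{(p)}(x)+q\int_a^xW^{(p+q)}(x-y)Z^{(p)}(y)\,dy.$$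
   Context: $X=\{X_t,t\ge 0\}$ is a spectrally negative L\'evy process (a c\`adl\`ag process with stationary independent increments and no positive jumps) that is not the negative of a subordinator. Its Laplace exponent $\psi$, defined by $\mathbb{E}[e^{\theta X_t}]=e^{t\psi(\theta)}$ for $\theta\ge 0$ (with $X_0=0$), is continuous and strictly convex on $[0,\infty)$ and tends to $\infty$ at $\infty$. $\Phi(\theta)=\inf\{s>0:\psi(s)>\theta\}$, $\theta\ge0$. For $r\ge 0$ the scale function $W^{(r)}:\mathbb{R}\to[0,\infty)$ vanishes on $(-\infty,0)$, is continuous and increasing on $[0,\infty)$, and satisfies $\int_0^\infty e^{-\theta y}W^{(r)}(y)\,dy=1/(\psi(\theta)-r)$ for $\theta>\Phi(r)$. $W:=W^{(0)}$, and $Z^{(r)}(x)=1+r\int_0^xW^{(r)}(y)\,dy$. The $\omega$-scale functions are the unique locally bounded functions on $\mathbb{R}$ satisfying $\mathcal{W}^{(\omega)}(x)=W(x)+\int_0^x W(x-y)\omega(y)\mathcal{W}^{(\omega)}(y)\,dy$ and $\mathcal{Z}^{(\omega)}(x)=1+\int_0^x W(x-y)\omega(y)\mathcal{Z}^{(\omega)}(y)\,dy$. Integrals $\int_a^x$ (respectively $\int_b^x$) are zero when $x<a$ (respectively $x<b$), because the scale functions vanish on $(-\infty,0)$. *)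

theory Defs
  imports "HOL-Probability.Probability"
begin

definition cadlag :: "(real \<Rightarrow> real) \<Rightarrow> bool" where
  "cadlag f \<longleftrightarrow> (\<forall>t\<ge>0. continuous (at_right t) f) \<and>
                (\<forall>t>0. \<exists>l. (f \<longlongrightarrow> l) (at_left t))"

text \<open>Processes are indexed by all reals, but only times \<open>t \<ge> 0\<close> are ever used.\<close>

definition levy_process :: "'a measure \<Rightarrow> (real \<Rightarrow> 'a \<Rightarrow> real) \<Rightarrow> bool" where
  "levy_process M X \<longleftrightarrow>
     prob_space M \<and>
     (\<forall>t\<ge>0. X t \<in> borel_measurable M) \<and>
     (AE w in M. X 0 w = 0) \<and>
     (AE w in M. cadlag (\<lambda>t. X t w)) \<and>
     (\<forall>(t :: nat \<Rightarrow> real) n. 0 \<le> t 0 \<and> (\<forall>i<n. t i \<le> t (Suc i)) \<longrightarrow>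
        prob_space.indep_vars M (\<lambda>_. borel) (\<lambda>i w. X (t (Suc i)) w - X (t i) w) {..<n}) \<and>
     (\<forall>s\<ge>0. \<forall>h\<ge>0. distr M borel (\<lambda>w. X (s + h) w - X s w) =
                    distr M borel (\<lambda>w. X h w - X 0 w))"

definition subordinator :: "'a measure \<Rightarrow> (real \<Rightarrow> 'a \<Rightarrow> real) \<Rightarrow> bool" where
  "subordinator M X \<longleftrightarrow> levy_process M X \<and> (AE w in M. mono_on {0..} (\<lambda>t. X t w))"

definition spectrally_negative_levy :: "'a measure \<Rightarrow> (real \<Rightarrow> 'a \<Rightarrow> real) \<Rightarrow> bool" where
  "spectrally_negative_levy M X \<longleftrightarrow>
     levy_process M X \<and>
     (AE w in M. \<forall>t>0. X t w - Lim (at_left t) (\<lambda>s. X s w) \<le> 0) \<and>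
     \<not> subordinator M (\<lambda>t w. - X t w)"

definition laplace_exponent ::
  "'a measure \<Rightarrow> (real \<Rightarrow> 'a \<Rightarrow> real) \<Rightarrow> (real \<Rightarrow> real) \<Rightarrow> bool" where
  "laplace_exponent M X \<psi> \<longleftrightarrow>
     (\<forall>\<theta>\<ge>0. \<forall>t\<ge>0. integrable M (\<lambda>w. exp (\<theta> * X t w)) \<and>
        (LINT w|M. exp (\<theta> * X t w)) = exp (t * \<psi> \<theta>))"

definition right_inverse :: "(real \<Rightarrow> real) \<Rightarrow> real \<Rightarrow> real" where
  "right_inverse \<psi> \<theta> = Inf {s. s > 0 \<and> \<psi> s > \<theta>}"

definition scale_function :: "(real \<Rightarrow> real) \<Rightarrow> real \<Rightarrow> (real \<Rightarrow> real) \<Rightarrow> bool" where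
  "scale_function \<psi> r W \<longleftrightarrow>
     (\<forall>x. 0 \<le> W x) \<and>
     (\<forall>x<0. W x = 0) \<and>
     continuous_on {0..} W \<and>
     mono_on {0..} W \<and>
     (\<forall>\<theta>>right_inverse \<psi> r.
        set_integrable lborel {0..} (\<lambda>y. exp (- \<theta> * y) * W y) \<and>
        (LINT y:{0..}|lborel. exp (- \<theta> * y) * W y) = 1 / (\<psi> \<theta> - r))"

text \<open>From here on \<open>W r\<close> is the \<open>r\<close>-scale function. An integral from \<open>a\<close> to \<open>x\<close> is taken over
  the set \<open>{a..x}\<close>, which is empty for \<open>x < a\<close>, so that the integral is then zero.\<close>

definition Z_scale :: "(real \<Rightarrow> real \<Rightarrow> real) \<Rightarrow> real \<Rightarrow> real \<Rightarrow> real" where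
  "Z_scale W r x = 1 + r * (LINT y:{0..x}|lborel. W r y)"

definition locally_bounded :: "(real \<Rightarrow> real) \<Rightarrow> bool" where
  "locally_bounded f \<longleftrightarrow> (\<forall>K. compact K \<longrightarrow> bounded (f ` K))"

text \<open>Measurability makes the integral equations meaningful: the Bochner integral of a
  non-measurable integrand is zero by convention.\<close>

definition omega_W_scale ::
  "(real \<Rightarrow> real \<Rightarrow> real) \<Rightarrow> (real \<Rightarrow> real) \<Rightarrow> (real \<Rightarrow> real) \<Rightarrow> bool" where
  "omega_W_scale W \<omega> f \<longleftrightarrow>
     f \<in> borel_measurable borel \<and> locally_bounded f \<and>
     (\<forall>x. f x = W 0 x + (LINT y:{0..x}|lborel. W 0 (x - y) * \<omega> y * f y))"

definition omega_Z_scale ::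
  "(real \<Rightarrow> real \<Rightarrow> real) \<Rightarrow> (real \<Rightarrow> real) \<Rightarrow> (real \<Rightarrow> real) \<Rightarrow> bool" where
  "omega_Z_scale W \<omega> f \<longleftrightarrow>
     f \<in> borel_measurable borel \<and> locally_bounded f \<and>
     (\<forall>x. f x = 1 + (LINT y:{0..x}|lborel. W 0 (x - y) * \<omega> y * f y))"

definition W_pq :: "(real \<Rightarrow> real \<Rightarrow> real) \<Rightarrow> real \<Rightarrow> real \<Rightarrow> real \<Rightarrow> real \<Rightarrow> real" where
  "W_pq W a p q x = W p x + q * (LINT y:{a..x}|lborel. W (p + q) (x - y) * W p y)"

definition Z_pq :: "(real \<Rightarrow> real \<Rightarrow> real) \<Rightarrow> real \<Rightarrow> real \<Rightarrow> real \<Rightarrow> real \<Rightarrow> real" where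
  "Z_pq W a p q x = Z_scale W p x + q * (LINT y:{a..x}|lborel. W (p + q) (x - y) * Z_scale W p y)"

end

theory Submission
  imports Defs
begin

text \<open>Uniqueness of Laplace transforms gives the resolvent identity \<open>W\<^sub>s - W\<^sub>r = (s - r) W\<^sub>s * W\<^sub>r\<close>,
  where \<open>*\<close> is convolution. By associativity, \<open>f = u + (s - r) W\<^sub>r * f\<close> then implies
  \<open>f = u + (s - r) W\<^sub>s * u\<close>. With \<open>r = 0\<close>, \<open>s = p\<close> this turns the \<open>\<omega>\<close>-equation into
  \<open>f = v + q W\<^sub>p * (1\<^bsub>(a,b)\<^esub> f)\<close>, where \<open>v\<close> is \<open>W\<^sub>p\<close> or \<open>Z\<^sub>p\<close>. With \<open>r = p\<close>, \<open>s = p + q\<close>, applied to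
  \<open>1\<^bsub>[a,\<infinity>)\<^esub> f\<close>, it shows that \<open>f\<close> agrees on \<open>(a,b)\<close> with
  \<open>A = v + q W\<^bsub>p+q\<^esub> * (1\<^bsub>[a,\<infinity>)\<^esub> v)\<close>, and that \<open>A = v + q W\<^sub>p * (1\<^bsub>[a,\<infinity>)\<^esub> A)\<close>. Subtracting the two
  equations yields \<open>f = A - q W\<^sub>p * (1\<^bsub>[b,\<infinity>)\<^esub> A)\<close>.\<close>

section \<open>Causal functions and their convolution algebra\<close>

text \<open>The class in which all convolution equations are solved. Vanishing on the negative axis
  together with a bound on every half-line below \<open>b\<close> makes each convolution integrand
  bounded with compact support, and convolution stays inside the class.\<close>

definition causal :: "(real \<Rightarrow> real) \<Rightarrow> bool" where
  "causal f \<longleftrightarrow> f \<in> borel_measurable borel \<and> (\<forall>x<0. f x = 0) \<and>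
     (\<forall>b. \<exists>C. \<forall>x\<le>b. \<bar>f x\<bar> \<le> C)"

text \<open>Integrating over the whole line keeps substitutions and Fubini free of limits; for
  causal arguments the integrand lives on \<open>{0..x}\<close>.\<close>

definition conv :: "(real \<Rightarrow> real) \<Rightarrow> (real \<Rightarrow> real) \<Rightarrow> real \<Rightarrow> real" where
  "conv f g x = (LINT y|lborel. f (x - y) * g y)"

lemma causal_measurable[measurable_dest]: "causal f \<Longrightarrow> f \<in> borel_measurable borel"
  by (simp add: causal_def)

lemma causal_neg: "causal f \<Longrightarrow> x < 0 \<Longrightarrow> f x = 0"
  by (simp add: causal_def)

lemma causal_bound:
  assumes "causal f"
  obtains C where "C \<ge> 0" "\<And>x. x \<le> b \<Longrightarrow> \<bar>f x\<bar> \<le> C"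
proof -
  obtain C where "\<forall>x\<le>b. \<bar>f x\<bar> \<le> C" using assms unfolding causal_def by blast
  then show ?thesis using that[of "max C 0"] by (meson max.cobounded1 max.cobounded2 order_trans)
qed

lemma causalI:
  assumes "f \<in> borel_measurable borel" "\<And>x. x < 0 \<Longrightarrow> f x = 0"
    "\<And>b. \<exists>C. \<forall>x\<in>{0..b}. \<bar>f x\<bar> \<le> C"
  shows "causal f"
  unfolding causal_def
proof (intro conjI allI)
  fix b
  obtain C where C: "\<forall>x\<in>{0..b}. \<bar>f x\<bar> \<le> C" using assms(3) by blast
  have "\<bar>f x\<bar> \<le> max C 0" if "x \<le> b" for x
    using C that assms(2)[of x] by (cases "x < 0") (auto simp: le_max_iff_disj)
  then show "\<exists>C. \<forall>x\<le>b. \<bar>f x\<bar> \<le> C" by blast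
qed (use assms in auto)

lemma causal_add:
  assumes "causal f" "causal g" shows "causal (\<lambda>x. f x + g x)"
proof (rule causalI)
  show "\<exists>C. \<forall>x\<in>{0..b}. \<bar>f x + g x\<bar> \<le> C" for b
  proof -
    obtain C where "\<And>x. x \<le> b \<Longrightarrow> \<bar>f x\<bar> \<le> C" using causal_bound[OF assms(1)] by blast
    moreover obtain D where "\<And>x. x \<le> b \<Longrightarrow> \<bar>g x\<bar> \<le> D" using causal_bound[OF assms(2)] by blast
    ultimately have "\<forall>x\<in>{0..b}. \<bar>f x + g x\<bar> \<le> C + D"
      by (metis abs_triangle_ineq add_mono atLeastAtMost_iff order_trans)
    then show ?thesis by blast
  qed
qed (use assms in \<open>auto simp: causal_def\<close>)

lemma causal_bounded_mult:
  assumes "causal f" "m \<in> borel_measurable borel" "\<And>x. \<bar>m x\<bar> \<le> D"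
  shows "causal (\<lambda>x. m x * f x)"
proof (rule causalI)
  show "\<exists>C. \<forall>x\<in>{0..b}. \<bar>m x * f x\<bar> \<le> C" for b
  proof -
    obtain C where "C \<ge> 0" and C: "\<And>x. x \<le> b \<Longrightarrow> \<bar>f x\<bar> \<le> C" using causal_bound[OF assms(1)] by blast
    have "\<bar>m x * f x\<bar> \<le> D * C" if "x \<le> b" for x
      unfolding abs_mult using C[OF that] assms(3)[of x] by (intro mult_mono) auto
    then show ?thesis by (intro exI[of _ "D*C"]) auto
  qed
qed (use assms in \<open>auto simp: causal_def\<close>)

lemma causal_cmult: "causal f \<Longrightarrow> causal (\<lambda>x. c * f x)"
  by (rule causal_bounded_mult) auto

lemma causal_indicator_mult: "causal f \<Longrightarrow> A \<in> sets borel \<Longrightarrow> causal (\<lambda>x. indicator A x * f x)"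
  by (rule causal_bounded_mult[where D = 1]) (auto simp: indicator_def)

text \<open>The integrand is supported on \<open>{0..x'}\<close>. The bound is uniform in
  \<open>x' \<le> x\<close>, so that the same majorant serves for integrability, for local
  boundedness and for dominated convergence.\<close>

lemma conv_integrand_bound:
  assumes "\<And>y. y \<le> x \<Longrightarrow> \<bar>f y\<bar> \<le> C" "\<And>y. y \<le> x \<Longrightarrow> \<bar>g y\<bar> \<le> D" "C \<ge> 0"
    and "causal f" "causal g" "x' \<le> x"
  shows "\<bar>f (x' - y) * g y\<bar> \<le> C * D * indicator {0..x} y"
proof (cases "0 \<le> y \<and> y \<le> x'")
  case True
  then have "\<bar>f (x' - y)\<bar> * \<bar>g y\<bar> \<le> C * D" using assms(1,2,3,6) by (intro mult_mono) auto
  then show ?thesis using True assms(6) by (simp add: abs_mult)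
next
  case False
  then have "f (x' - y) * g y = 0" using causal_neg[OF assms(4), of "x' - y"] causal_neg[OF assms(5), of y]
    by fastforce
  moreover have "0 \<le> C * D" if "y \<in> {0..x}" using assms(2)[of y] that assms(3) by (auto intro: mult_nonneg_nonneg)
  ultimately show ?thesis by (auto simp: indicator_def)
qed

lemma conv_integrable:
  assumes f: "causal f" and g: "causal g"
  shows "integrable lborel (\<lambda>y. f (x - y) * g y)"
proof -
  note [measurable] = causal_measurable[OF f] causal_measurable[OF g]
  obtain C where "C \<ge> 0" "\<And>y. y \<le> x \<Longrightarrow> \<bar>f y\<bar> \<le> C" using causal_bound[OF f] by blast
  moreover obtain D where "\<And>y. y \<le> x \<Longrightarrow> \<bar>g y\<bar> \<le> D" using causal_bound[OF g] by blast
  ultimately have bound: "\<bar>f (x - y) * g y\<bar> \<le> C * D * indicator {0..x} y" for y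
    using conv_integrand_bound f g by blast
  show ?thesis
  proof (rule Bochner_Integration.integrable_bound)
    show "integrable lborel (\<lambda>y. C * D * indicator {0..x} y)"
      by (intro integrable_mult_right integrable_real_indicator) (auto simp: emeasure_lborel_Icc_eq)
    show "AE y in lborel. norm (f (x - y) * g y) \<le> norm (C * D * indicator {0..x} y)"
      unfolding real_norm_def by (intro AE_I2 order_trans[OF bound abs_ge_self])
  qed measurable
qed

lemma conv_neg:
  assumes "causal f" "causal g" "x < 0"
  shows "conv f g x = 0"
proof -
  have "f (x - y) * g y = 0" for y
    using causal_neg[OF assms(1), of "x - y"] causal_neg[OF assms(2), of y] assms(3) by (cases "y < 0") auto
  then show ?thesis by (simp only: conv_def integral_zero)
qed

lemma causal_conv:
  assumes f: "causal f" and g: "causal g"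
  shows "causal (conv f g)"
proof (rule causalI)
  note [measurable] = causal_measurable[OF f] causal_measurable[OF g]
  show "conv f g \<in> borel_measurable borel" unfolding conv_def by measurable
  show "\<exists>C. \<forall>x\<in>{0..b}. \<bar>conv f g x\<bar> \<le> C" for b
  proof -
    obtain C where C: "C \<ge> 0" "\<And>y. y \<le> b \<Longrightarrow> \<bar>f y\<bar> \<le> C" using causal_bound[OF f] by blast
    obtain D where D: "\<And>y. y \<le> b \<Longrightarrow> \<bar>g y\<bar> \<le> D" using causal_bound[OF g] by blast
    have "\<bar>conv f g x\<bar> \<le> (LINT y|lborel. C * D * indicator {0..b} y)" if "x \<le> b" for x
      unfolding conv_def
      by (rule integral_abs_bound[THEN order_trans], rule integral_mono)
        (use conv_integrand_bound[of b f C g D x] C D f g that in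
          \<open>auto intro!: conv_integrable integrable_abs simp: emeasure_lborel_Icc_eq\<close>)
    then show ?thesis by (metis atLeastAtMost_iff)
  qed
qed (use conv_neg[OF f g] in auto)

lemma conv_commute: "conv f g = conv g f"
proof
  show "conv f g x = conv g f x" for x
    unfolding conv_def
    by (subst lborel_integral_real_affine[where c = "-1" and t = x]) (auto simp: mult.commute)
qed

lemma conv_add_right:
  assumes "causal f" "causal g" "causal h"
  shows "conv f (\<lambda>x. g x + h x) = (\<lambda>x. conv f g x + conv f h x)"
  using assms by (auto simp: conv_def distrib_left conv_integrable)

lemma conv_cmult_right: "conv f (\<lambda>x. c * g x) = (\<lambda>x. c * conv f g x)"
proof
  show "conv f (\<lambda>x. c * g x) x = c * conv f g x" for x
    unfolding conv_def by (simp add: mult.left_commute flip: integral_mult_right_zero)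
qed

lemma conv_add_left:
  assumes "causal f" "causal g" "causal h"
  shows "conv (\<lambda>x. g x + h x) f = (\<lambda>x. conv g f x + conv h f x)"
  using conv_add_right[OF assms] by (simp add: conv_commute)

lemma conv_cmult_left: "conv (\<lambda>x. c * f x) g = (\<lambda>x. c * conv f g x)"
  by (metis conv_cmult_right conv_commute)

text \<open>Fubini applies because the triple product is bounded and supported on
  \<open>0 \<le> y \<le> z \<le> x\<close>; the inner variable is first shifted by
  \<open>y\<close>.\<close>

lemma conv_assoc:
  assumes f: "causal f" and g: "causal g" and h: "causal h"
  shows "conv (conv f g) h = conv f (conv g h)"
proof
  fix x
  note [measurable] = causal_measurable[OF f] causal_measurable[OF g] causal_measurable[OF h]
  let ?F = "\<lambda>y z. f (x - z) * (g (z - y) * h y)"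
  obtain C where C: "C \<ge> 0" "\<And>y. y \<le> x \<Longrightarrow> \<bar>f y\<bar> \<le> C" using causal_bound[OF f] by blast
  obtain D where D: "D \<ge> 0" "\<And>y. y \<le> x \<Longrightarrow> \<bar>g y\<bar> \<le> D" using causal_bound[OF g] by blast
  obtain E where E: "E \<ge> 0" "\<And>y. y \<le> x \<Longrightarrow> \<bar>h y\<bar> \<le> E" using causal_bound[OF h] by blast
  have bound: "\<bar>?F y z\<bar> \<le> C * (D * E) * indicator ({0..x} \<times> {0..x}) (y, z)" for y z
  proof (cases "0 \<le> y \<and> y \<le> z \<and> z \<le> x")
    case True
    then show ?thesis
      unfolding abs_mult using C D E by (auto intro!: mult_mono)
  next
    case False
    then have "?F y z = 0"
      using causal_neg[OF f, of "x - z"] causal_neg[OF g, of "z - y"] causal_neg[OF h, of y] by fastforce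
    then show ?thesis using C D E by (auto simp: indicator_def)
  qed
  have "integrable (lborel \<Otimes>\<^sub>M lborel) (\<lambda>p. C * (D * E) * indicator ({0..x} \<times> {0..x}) p :: real)"
    by (intro integrable_mult_right integrable_real_indicator)
      (auto simp: lborel.emeasure_pair_measure_Times ennreal_mult_less_top emeasure_lborel_Icc_eq)
  then have int: "integrable (lborel \<Otimes>\<^sub>M lborel) (case_prod ?F)"
  proof (rule Bochner_Integration.integrable_bound)
    show "AE p in lborel \<Otimes>\<^sub>M lborel. norm (case_prod ?F p)
        \<le> norm (C * (D * E) * indicator ({0..x} \<times> {0..x}) p :: real)"
      by (intro AE_I2, clarify, unfold real_norm_def prod.case, rule order_trans[OF bound abs_ge_self])
  qed measurable
  have "conv (conv f g) h x = (LINT y|lborel. (LINT z|lborel. f (x - y - z) * g z) * h y)"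
    by (simp add: conv_def)
  also have "\<dots> = (LINT y|lborel. (LINT z|lborel. f (x - z) * g (z - y)) * h y)"
  proof (intro Bochner_Integration.integral_cong refl)
    fix y
    show "(LINT z|lborel. f (x - y - z) * g z) * h y = (LINT z|lborel. f (x - z) * g (z - y)) * h y"
      by (subst lborel_integral_real_affine[where c = 1 and t = "- y"]) (auto simp: algebra_simps)
  qed
  also have "\<dots> = (LINT y|lborel. LINT z|lborel. ?F y z)"
    by (simp add: mult.assoc flip: integral_mult_left_zero)
  also have "\<dots> = (LINT z|lborel. LINT y|lborel. ?F y z)"
    by (rule lborel_pair.Fubini_integral[OF int, symmetric])
  also have "\<dots> = conv f (conv g h) x"
    by (simp add: conv_def)
  finally show "conv (conv f g) h x = conv f (conv g h) x" .
qed

lemma conv_cong_AE: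
  assumes "causal f" "causal g" "causal h" "AE y in lborel. g y = h y"
  shows "conv f g = conv f h"
proof
  note [measurable] = causal_measurable[OF assms(1)] causal_measurable[OF assms(2)] causal_measurable[OF assms(3)]
  show "conv f g x = conv f h x" for x
    unfolding conv_def by (rule integral_cong_AE) (use assms(4) in auto)
qed

text \<open>Since \<open>f (x - y)\<close> vanishes for \<open>y > x\<close>, the convolution at
  \<open>x\<close> sees the second factor only up to \<open>x\<close>. This is what localizes
  equations to the left of \<open>a\<close> or \<open>b\<close>.\<close>

lemma conv_cong_below:
  assumes "causal f" "\<And>y. y \<le> x \<Longrightarrow> g y = h y"
  shows "conv f g x = conv f h x"
  unfolding conv_def
proof (intro Bochner_Integration.integral_cong refl)
  show "f (x - y) * g y = f (x - y) * h y" for y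
    using assms(2)[of y] causal_neg[OF assms(1), of "x - y"] by fastforce
qed

text \<open>Causality of \<open>f\<close> supplies the upper limit \<open>x\<close>, so only the
  lower limit needs an indicator. For \<open>x < a\<close> both sides are zero.\<close>

lemma set_lebesgue_integral_eq_conv:
  assumes "causal f"
  shows "(LINT y:{a..x}|lborel. f (x - y) * g y) = conv f (\<lambda>y. indicator {a..} y * g y) x"
  unfolding conv_def set_lebesgue_integral_def
proof (intro Bochner_Integration.integral_cong refl)
  show "indicator {a..x} y *\<^sub>R (f (x - y) * g y) = f (x - y) * (indicator {a..} y * g y)" for y
    using causal_neg[OF assms, of "x - y"] by (auto simp: indicator_def)
qed

section \<open>Continuity of convolutions and Laplace transforms\<close>

text \<open>The only possible discontinuity of \<open>f\<close> is a jump at 0, which affects the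
  integrand at the single point \<open>y = x\<close>; dominated convergence does the rest.\<close>

lemma conv_continuous:
  assumes f: "causal f" "continuous_on {0..} f" and g: "causal g"
  shows "continuous_on A (conv f g)"
proof (rule continuous_on_subset[OF _ subset_UNIV], rule continuous_at_imp_continuous_on, intro ballI)
  fix x :: real
  note [measurable] = causal_measurable[OF f(1)] causal_measurable[OF g]
  have cont: "isCont f t" if "t \<noteq> 0" for t
  proof (cases "t > 0")
    case True
    then show ?thesis using f(2)
      by (metis atLeast_iff continuous_on_interior interior_real_atLeast greaterThan_iff)
  next
    case False
    have "continuous_on {..<0} (\<lambda>_. 0 :: real)" by simp
    then have "continuous_on {..<0} f"
      by (rule continuous_on_eq) (use causal_neg[OF f(1)] in auto)
    then show ?thesis using False that by (metis continuous_on_eq_continuous_at lessThan_iff linorder_neqE open_lessThan)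
  qed
  show "isCont (conv f g) x"
    unfolding continuous_at_sequentially comp_def
  proof (intro allI impI)
    fix X assume X: "X \<longlonglongrightarrow> x"
    then have "bounded (range X)" by (intro convergent_imp_bounded) auto
    then obtain B where B: "\<And>n. \<bar>X n\<bar> \<le> B" by (auto simp: bounded_iff)
    obtain C where C: "C \<ge> 0" "\<And>y. y \<le> B \<Longrightarrow> \<bar>f y\<bar> \<le> C" using causal_bound[OF f(1)] by blast
    obtain D where D: "\<And>y. y \<le> B \<Longrightarrow> \<bar>g y\<bar> \<le> D" using causal_bound[OF g] by blast
    show "(\<lambda>n. conv f g (X n)) \<longlonglongrightarrow> conv f g x"
      unfolding conv_def
    proof (rule integral_dominated_convergence[where w = "\<lambda>y. C * D * indicator {0..B} y"])
      have "(\<lambda>n. f (X n - y) * g y) \<longlonglongrightarrow> f (x - y) * g y" if "y \<noteq> x" for y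
        using that by (intro tendsto_mult isCont_tendsto_compose[OF cont] tendsto_diff X tendsto_const) auto
      then show "AE y in lborel. (\<lambda>n. f (X n - y) * g y) \<longlonglongrightarrow> f (x - y) * g y"
        using AE_lborel_singleton[of x] by (auto elim: eventually_mono)
      show "AE y in lborel. norm (f (X n - y) * g y) \<le> C * D * indicator {0..B} y" for n
        using conv_integrand_bound[of B f C g D "X n"] C D f g B[of n] by (intro AE_I2) auto
    qed (auto simp: emeasure_lborel_Icc_eq)
  qed
qed

text \<open>The substitution \<open>u = exp (- y)\<close> makes all moments of \<open>exp (- c y) h y\<close> vanish, so by Weierstrass it
  is orthogonal to every \<open>g (exp (- y))\<close> with \<open>g\<close> continuous on \<open>{0..1}\<close>; \<open>g\<close> is chosen such that
  \<open>g (exp (- y))\<close> is \<open>h y\<close> times the positive part of \<open>N - y\<close>.\<close>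

lemma Laplace_unique:
  fixes h :: "real \<Rightarrow> real"
  assumes cont: "continuous_on {0..} h"
    and int: "\<And>\<theta>. \<theta> > \<eta> \<Longrightarrow> set_integrable lborel {0..} (\<lambda>y. exp (- \<theta> * y) * h y)"
    and zero: "\<And>\<theta>. \<theta> > \<eta> \<Longrightarrow> (LINT y:{0..}|lborel. exp (- \<theta> * y) * h y) = 0"
    and x: "x \<ge> 0"
  shows "h x = 0"
proof -
  \<comment> \<open>With this choice every \<open>c + n\<close>, including \<open>n = 0\<close>,
    exceeds \<eta>, so \<open>K\<close> itself is integrable and all its moments vanish.\<close>
  define c where "c = \<eta> + 1"
  define K where "K y = indicator {0..} y * (exp (- c * y) * h y)" for y
  have Kn: "K y * exp (- y) ^ n = indicator {0..} y *\<^sub>R (exp (- (c + real n) * y) * h y)" for y n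
    by (simp add: K_def algebra_simps exp_add[symmetric] flip: exp_of_nat_mult)
  have K_int_n: "integrable lborel (\<lambda>y. K y * exp (- y) ^ n)" for n
    using int[of "c + real n"] unfolding Kn set_integrable_def by (simp add: c_def)
  have K_zero_n: "(LINT y|lborel. K y * exp (- y) ^ n) = 0" for n
    using zero[of "c + real n"] unfolding Kn set_lebesgue_integral_def by (simp add: c_def)
  have K_int: "integrable lborel K" using K_int_n[of 0] by simp
  have [measurable]: "K \<in> borel_measurable borel" using K_int by auto
  \<comment> \<open>Any \<open>N > x\<close> would do: the weight \<open>N - y\<close> must be
    positive at \<open>y = x\<close>.\<close>
  define N where "N = x + 1"
  define T where "T y = (N - y) * h y" for y
  \<comment> \<open>Clamping \<open>u\<close> at \<open>exp (- N)\<close> keeps the logarithm away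
    from 0. Below the clamp \<open>g\<close> has the constant value \<open>T N = 0\<close>, so
    \<open>g\<close> is continuous on \<open>{0..1}\<close> and \<open>g (exp (- y))\<close>
    vanishes for \<open>y \<ge> N\<close>.\<close>
  define g where "g u = T (- ln (max u (exp (- N))))" for u
  have "continuous_on {0..N} T"
    unfolding T_def by (intro continuous_intros continuous_on_subset[OF cont]) auto
  then have g_cont: "continuous_on {0..1} g"
    unfolding g_def
  proof (rule continuous_on_compose2)
    show "continuous_on {0..1} (\<lambda>u. - ln (max u (exp (- N))))"
      by (intro continuous_intros) (auto simp: max_def not_le dest: exp_gt_zero[THEN less_le_trans])
    show "(\<lambda>u. - ln (max u (exp (- N)))) ` {0..1} \<subseteq> {0..N}"
    proof clarify
      fix u :: real assume "u \<in> {0..1}"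
      then have m: "exp (- N) \<le> max u (exp (- N))" "max u (exp (- N)) \<le> 1" "0 < max u (exp (- N))"
        using x by (auto simp: N_def less_max_iff_disj)
      then have "ln (exp (- N)) \<le> ln (max u (exp (- N)))" by (subst ln_le_cancel_iff) auto
      moreover have "ln (max u (exp (- N))) \<le> 0" using m by simp
      ultimately show "- ln (max u (exp (- N))) \<in> {0..N}" by simp
    qed
  qed
  have g_exp: "K y * g (exp (- y)) = indicator {0..N} y * ((N - y) * exp (- c * y) * (h y)\<^sup>2)" for y
  proof (cases "y \<le> N")
    case True
    then have "max (exp (- y)) (exp (- N)) = exp (- y)" by simp
    then show ?thesis using True by (auto simp: g_def K_def T_def power2_eq_square indicator_def)
  next
    case False
    then have "max (exp (- y)) (exp (- N)) = exp (- N)" by simp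
    then show ?thesis using False by (simp add: g_def T_def)
  qed
  have small: "\<bar>LINT y|lborel. K y * g (exp (- y))\<bar> \<le> e * (LINT y|lborel. \<bar>K y\<bar>)"
    and g_int: "integrable lborel (\<lambda>y. K y * g (exp (- y)))" if e: "e > 0" for e
  proof -
    obtain p where "real_polynomial_function p" and p: "\<And>u. u \<in> {0..1} \<Longrightarrow> \<bar>g u - p u\<bar> < e"
      using Stone_Weierstrass_real_polynomial_function[OF compact_Icc g_cont e] by blast
    then obtain \<alpha> m where P: "p = (\<lambda>u. \<Sum>i\<le>m. \<alpha> i * u ^ i)"
      by (auto simp: real_polynomial_function_iff_sum)
    have Kp: "K y * p (exp (- y)) = (\<Sum>i\<le>m. \<alpha> i * (K y * exp (- y) ^ i))" for y
      by (simp add: P sum_distrib_left algebra_simps)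
    have p_int: "integrable lborel (\<lambda>y. K y * p (exp (- y)))"
      unfolding Kp using K_int_n by (intro Bochner_Integration.integrable_sum integrable_mult_right) auto
    have p_zero: "(LINT y|lborel. K y * p (exp (- y))) = 0"
      unfolding Kp using K_int_n K_zero_n by (subst Bochner_Integration.integral_sum) auto
    have bound: "\<bar>K y * g (exp (- y)) - K y * p (exp (- y))\<bar> \<le> e * \<bar>K y\<bar>" for y
    proof (cases "y \<ge> 0")
      case True
      have "\<bar>K y * g (exp (- y)) - K y * p (exp (- y))\<bar> = \<bar>g (exp (- y)) - p (exp (- y))\<bar> * \<bar>K y\<bar>"
        by (simp add: abs_mult[symmetric] algebra_simps)
      also have "\<dots> \<le> e * \<bar>K y\<bar>" using p[of "exp (- y)"] True by (intro mult_right_mono) auto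
      finally show ?thesis .
    qed (simp add: K_def)
    have "continuous_on {0..N} (\<lambda>y. (N - y) * exp (- c * y) * (h y)\<^sup>2)"
      by (intro continuous_intros continuous_on_subset[OF cont]) auto
    then have "set_integrable lborel {0..N} (\<lambda>y. (N - y) * exp (- c * y) * (h y)\<^sup>2)"
      by (rule borel_integrable_atLeastAtMost')
    then show gi: "integrable lborel (\<lambda>y. K y * g (exp (- y)))"
      unfolding g_exp set_integrable_def by simp
    have "\<bar>LINT y|lborel. K y * g (exp (- y))\<bar> = \<bar>LINT y|lborel. K y * g (exp (- y)) - K y * p (exp (- y))\<bar>"
      using p_zero gi p_int by (subst Bochner_Integration.integral_diff) auto
    also have "\<dots> \<le> (LINT y|lborel. e * \<bar>K y\<bar>)"
      by (rule integral_abs_bound[THEN order_trans], rule integral_mono)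
        (use gi p_int K_int bound in auto)
    finally show "\<bar>LINT y|lborel. K y * g (exp (- y))\<bar> \<le> e * (LINT y|lborel. \<bar>K y\<bar>)" by simp
  qed
  have "(LINT y|lborel. K y * g (exp (- y))) = 0"
  proof (rule ccontr)
    define I J where "I = \<bar>LINT y|lborel. K y * g (exp (- y))\<bar>" and "J = (LINT y|lborel. \<bar>K y\<bar>)"
    assume "(LINT y|lborel. K y * g (exp (- y))) \<noteq> 0"
    then have "I > 0" by (simp add: I_def)
    have "J \<ge> 0" by (simp add: J_def)
    \<comment> \<open>The estimate with \<open>e = I / (2 * (J + 1))\<close>; adding 1 keeps the
      denominator positive when \<open>J = 0\<close>.\<close>
    have "I \<le> I / (2 * (J + 1)) * J"
      unfolding I_def J_def by (rule small, fold I_def J_def) (use \<open>I > 0\<close> \<open>J \<ge> 0\<close> in simp)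
    also have "\<dots> < I" using \<open>I > 0\<close> \<open>J \<ge> 0\<close> by (simp add: field_simps add_strict_increasing)
    finally show False by simp
  qed
  then have z: "(LINT y:{0..N}|lborel. (N - y) * exp (- c * y) * (h y)\<^sup>2) = 0"
    unfolding g_exp set_lebesgue_integral_def by simp
  have ct: "continuous_on {0..N} (\<lambda>y. (N - y) * exp (- c * y) * (h y)\<^sup>2)"
    by (intro continuous_intros continuous_on_subset[OF cont]) auto
  note si = borel_integrable_atLeastAtMost'[OF ct]
  have "((\<lambda>y. (N - y) * exp (- c * y) * (h y)\<^sup>2) has_integral 0) {0..N}"
    using set_borel_integral_eq_integral[OF si] z by (metis integrable_integral)
  \<comment> \<open>A continuous nonnegative function with integral zero vanishes pointwise.\<close>
  then have "(N - x) * exp (- c * x) * (h x)\<^sup>2 = 0"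
    using has_integral_0_cbox_imp_0[of 0 N "\<lambda>y. (N - y) * exp (- c * y) * (h y)\<^sup>2" x] ct x
    by (auto simp: N_def)
  then show ?thesis by (simp add: N_def)
qed

text \<open>The weight factors as \<open>exp (- \<theta> * (x - y)) * exp (- \<theta> * y)\<close>.
  As both functions are nonnegative, Tonelli yields integrability and the product formula
  together.\<close>

lemma Laplace_conv:
  assumes f: "causal f" "\<And>x. f x \<ge> 0" "set_integrable lborel {0..} (\<lambda>y. exp (- \<theta> * y) * f y)"
    and g: "causal g" "\<And>x. g x \<ge> 0" "set_integrable lborel {0..} (\<lambda>y. exp (- \<theta> * y) * g y)"
  shows "set_integrable lborel {0..} (\<lambda>y. exp (- \<theta> * y) * conv f g y)"
    and "(LINT y:{0..}|lborel. exp (- \<theta> * y) * conv f g y) =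
      (LINT y:{0..}|lborel. exp (- \<theta> * y) * f y) * (LINT y:{0..}|lborel. exp (- \<theta> * y) * g y)"
proof -
  note [measurable] = causal_measurable[OF f(1)] causal_measurable[OF g(1)]
    causal_measurable[OF causal_conv[OF f(1) g(1)]]
  have ind: "indicator {0..} y *\<^sub>R (exp (- \<theta> * y) * k y) = exp (- \<theta> * y) * k y" if "causal k" for k y
    using causal_neg[OF that, of y] by (auto simp: indicator_def)
  define F G where "F y = exp (- \<theta> * y) * f y" and "G y = exp (- \<theta> * y) * g y" for y
  have [measurable]: "F \<in> borel_measurable borel" "G \<in> borel_measurable borel" by (auto simp: F_def[abs_def] G_def[abs_def])
  have nn: "F y \<ge> 0" "G y \<ge> 0" for y using f(2) g(2) by (auto simp: F_def G_def)
  have int: "integrable lborel F" "integrable lborel G"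
    using f(3) g(3) unfolding set_integrable_def ind[OF f(1)] ind[OF g(1)] F_def[abs_def] G_def[abs_def] by auto
  have H: "ennreal (exp (- \<theta> * x) * conv f g x) = (\<integral>\<^sup>+y. ennreal (F (x - y)) * ennreal (G y) \<partial>lborel)" for x
  proof -
    have FG: "F (x - y) * G y = exp (- \<theta> * x) * (f (x - y) * g y)" for y
      by (simp add: F_def G_def algebra_simps flip: exp_add)
    have "exp (- \<theta> * x) * conv f g x = (LINT y|lborel. F (x - y) * G y)"
      unfolding FG by (simp add: conv_def)
    moreover have "integrable lborel (\<lambda>y. F (x - y) * G y)"
      unfolding FG using conv_integrable[OF f(1) g(1)] by simp
    ultimately have "ennreal (exp (- \<theta> * x) * conv f g x) = (\<integral>\<^sup>+y. ennreal (F (x - y) * G y) \<partial>lborel)"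
      using nn by (simp add: nn_integral_eq_integral)
    then show ?thesis using nn by (simp add: ennreal_mult)
  qed
  have shift: "(\<integral>\<^sup>+x. ennreal (F (x - y)) \<partial>lborel) = (\<integral>\<^sup>+x. ennreal (F x) \<partial>lborel)" for y
    by (subst nn_integral_real_affine[where c = 1 and t = y]) auto
  have "(\<integral>\<^sup>+x. ennreal (exp (- \<theta> * x) * conv f g x) \<partial>lborel) =
      (\<integral>\<^sup>+y. \<integral>\<^sup>+x. ennreal (F (x - y)) * ennreal (G y) \<partial>lborel \<partial>lborel)"
    unfolding H by (rule lborel_pair.Fubini') measurable
  also have "\<dots> = (\<integral>\<^sup>+x. ennreal (F x) \<partial>lborel) * (\<integral>\<^sup>+y. ennreal (G y) \<partial>lborel)"
    by (simp add: nn_integral_multc shift nn_integral_cmult)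
  also have "\<dots> = ennreal (integral\<^sup>L lborel F * integral\<^sup>L lborel G)"
    using int nn by (simp add: nn_integral_eq_integral ennreal_mult)
  finally have eq: "(\<integral>\<^sup>+x. ennreal (exp (- \<theta> * x) * conv f g x) \<partial>lborel)
      = ennreal (integral\<^sup>L lborel F * integral\<^sup>L lborel G)" .
  have cnn: "conv f g x \<ge> 0" for x unfolding conv_def using f(2) g(2) by (intro integral_nonneg_AE) auto
  have "integrable lborel (\<lambda>x. exp (- \<theta> * x) * conv f g x)"
    by (rule integrableI_nn_integral_finite[OF _ _ eq]) (use cnn in auto)
  then show "set_integrable lborel {0..} (\<lambda>y. exp (- \<theta> * y) * conv f g y)"
    unfolding set_integrable_def ind[OF causal_conv[OF f(1) g(1)]] .
  have "(LINT x|lborel. exp (- \<theta> * x) * conv f g x) = integral\<^sup>L lborel F * integral\<^sup>L lborel G"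
    by (subst integral_eq_nn_integral) (use eq cnn nn in auto)
  then show "(LINT y:{0..}|lborel. exp (- \<theta> * y) * conv f g y) =
      (LINT y:{0..}|lborel. exp (- \<theta> * y) * f y) * (LINT y:{0..}|lborel. exp (- \<theta> * y) * g y)"
    unfolding set_lebesgue_integral_def ind[OF causal_conv[OF f(1) g(1)]] ind[OF f(1)] ind[OF g(1)]
      F_def[abs_def] G_def[abs_def] .
qed

section \<open>Scale functions and the resolvent identity\<close>

lemma scale_function_causal:
  assumes "scale_function \<psi> r w"
  shows "causal w"
proof (rule causalI)
  have w: "continuous_on {0..} w" "mono_on {0..} w" "\<And>x. w x \<ge> 0" "\<And>x. x < 0 \<Longrightarrow> w x = 0"
    using assms by (auto simp: scale_function_def)
  have "w = (\<lambda>x. indicator {0..} x *\<^sub>R w x)" using w(4) by (auto simp: indicator_def fun_eq_iff)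
  then show "w \<in> borel_measurable borel"
    using borel_measurable_continuous_on_indicator[OF _ w(1)] by simp
  show "x < 0 \<Longrightarrow> w x = 0" for x by (rule w(4))
  show "\<exists>C. \<forall>x\<in>{0..b}. \<bar>w x\<bar> \<le> C" for b
    using w(2,3) by (intro exI[of _ "w b"]) (auto simp: mono_on_def)
qed

text \<open>The Laplace transform of the nonnegative function \<open>W r'\<close> is nonnegative, which forces \<open>\<psi> \<theta> \<ge> r'\<close>
  for large \<open>\<theta>\<close> (even with \<open>1 / 0 = 0\<close>); taking \<open>r' = r + 1\<close> keeps \<open>\<psi> \<theta> - r\<close> away from zero.\<close>

lemma Laplace_scale_function:
  assumes W: "\<And>r. r \<ge> 0 \<Longrightarrow> scale_function \<psi> r (W r)" and "r \<ge> 0"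
  obtains \<eta> where "\<And>\<theta>. \<theta> > \<eta> \<Longrightarrow> \<psi> \<theta> > r \<and>
    set_integrable lborel {0..} (\<lambda>y. exp (- \<theta> * y) * W r y) \<and>
    (LINT y:{0..}|lborel. exp (- \<theta> * y) * W r y) = 1 / (\<psi> \<theta> - r)"
proof (rule that)
  fix \<theta> assume \<theta>: "\<theta> > max (right_inverse \<psi> r) (right_inverse \<psi> (r + 1))"
  have 1: "scale_function \<psi> (r + 1) (W (r + 1))" using W[of "r + 1"] \<open>r \<ge> 0\<close> by simp
  have "0 \<le> (LINT y:{0..}|lborel. exp (- \<theta> * y) * W (r + 1) y)"
    unfolding set_lebesgue_integral_def using 1 by (intro integral_nonneg_AE) (auto simp: scale_function_def)
  also have "\<dots> = 1 / (\<psi> \<theta> - (r + 1))" using 1 \<theta> by (auto simp: scale_function_def)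
  finally have "\<psi> \<theta> > r" by (simp add: zero_le_divide_iff)
  then show "\<psi> \<theta> > r \<and> set_integrable lborel {0..} (\<lambda>y. exp (- \<theta> * y) * W r y) \<and>
    (LINT y:{0..}|lborel. exp (- \<theta> * y) * W r y) = 1 / (\<psi> \<theta> - r)"
    using W[OF \<open>r \<ge> 0\<close>] \<theta> by (auto simp: scale_function_def)
qed

text \<open>On the Laplace side this is \<open>1 / (\<psi> \<theta> - s) - 1 / (\<psi> \<theta> - r)
  = (s - r) / ((\<psi> \<theta> - s) * (\<psi> \<theta> - r))\<close>. The difference of the two
  sides is continuous on \<open>{0..}\<close>, so uniqueness applies there; on the negative axis
  everything is zero.\<close>

lemma scale_function_resolvent:
  assumes W: "\<And>r. r \<ge> 0 \<Longrightarrow> scale_function \<psi> r (W r)" and "r \<ge> 0" "s \<ge> 0"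
  shows "W s x = W r x + (s - r) * conv (W s) (W r) x"
proof (cases "x < 0")
  case True
  then show ?thesis
    using W[OF \<open>r \<ge> 0\<close>] W[OF \<open>s \<ge> 0\<close>] conv_neg[OF scale_function_causal scale_function_causal]
    by (auto simp: scale_function_def)
next
  case False
  note r = W[OF \<open>r \<ge> 0\<close>] and s = W[OF \<open>s \<ge> 0\<close>]
  note cr = scale_function_causal[OF r] and cs = scale_function_causal[OF s]
  have nn: "W r x \<ge> 0" "W s x \<ge> 0" for x using r s by (auto simp: scale_function_def)
  have cont: "continuous_on {0..} (W r)" "continuous_on {0..} (W s)" using r s by (auto simp: scale_function_def)
  obtain t1 where t1: "\<And>\<theta>. \<theta> > t1 \<Longrightarrow> \<psi> \<theta> > r \<and>
    set_integrable lborel {0..} (\<lambda>y. exp (- \<theta> * y) * W r y) \<and>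
    (LINT y:{0..}|lborel. exp (- \<theta> * y) * W r y) = 1 / (\<psi> \<theta> - r)"
    using Laplace_scale_function[OF W \<open>r \<ge> 0\<close>] by blast
  obtain t2 where t2: "\<And>\<theta>. \<theta> > t2 \<Longrightarrow> \<psi> \<theta> > s \<and>
    set_integrable lborel {0..} (\<lambda>y. exp (- \<theta> * y) * W s y) \<and>
    (LINT y:{0..}|lborel. exp (- \<theta> * y) * W s y) = 1 / (\<psi> \<theta> - s)"
    using Laplace_scale_function[OF W \<open>s \<ge> 0\<close>] by blast
  let ?h = "\<lambda>x. W s x - W r x - (s - r) * conv (W s) (W r) x"
  have "?h x = 0"
  proof (rule Laplace_unique[where \<eta> = "max t1 t2" and h = ?h])
    show "continuous_on {0..} ?h"
      by (intro continuous_intros cont conv_continuous cs cr)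
    fix \<theta> assume "\<theta> > max t1 t2"
    then have "\<theta> > t1" "\<theta> > t2" by auto
    note R = t1[OF this(1)] and S = t2[OF this(2)]
    note C = Laplace_conv[where \<theta> = \<theta> and f = "W s" and g = "W r", OF cs nn(2) _ cr nn(1)]
    have C1: "set_integrable lborel {0..} (\<lambda>y. (s - r) * (exp (- \<theta> * y) * conv (W s) (W r) y))"
      using C(1) R S by (intro set_integrable_mult_right) auto
    have eq: "exp (- \<theta> * y) * ?h y = (exp (- \<theta> * y) * W s y - exp (- \<theta> * y) * W r y)
        - (s - r) * (exp (- \<theta> * y) * conv (W s) (W r) y)" for y
      by (simp add: algebra_simps)
    show "set_integrable lborel {0..} (\<lambda>y. exp (- \<theta> * y) * ?h y)"
      unfolding eq using R S C1 by (intro set_integral_diff) auto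
    have "(LINT y:{0..}|lborel. exp (- \<theta> * y) * ?h y)
        = 1 / (\<psi> \<theta> - s) - 1 / (\<psi> \<theta> - r) - (s - r) * (1 / (\<psi> \<theta> - s) * (1 / (\<psi> \<theta> - r)))"
      unfolding eq using R S C1 C(2) by (simp add: set_integral_diff)
    also have "\<dots> = 0" using R S by (simp add: field_simps)
    finally show "(LINT y:{0..}|lborel. exp (- \<theta> * y) * ?h y) = 0" .
  qed (use False in auto)
  then show ?thesis by simp
qed

section \<open>Solving the convolution equations\<close>

text \<open>Expand \<open>conv w' f\<close> twice, once through the equation for \<open>f\<close>
  and once through the identity for \<open>w'\<close>. The double convolutions agree by
  associativity and cancel, which leaves \<open>conv w f = conv w' u\<close>. The sign of
  \<open>c\<close> is free, so the rate can be raised or lowered.\<close>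

lemma resolvent_solve:
  assumes w: "causal w" "causal w'" and res: "\<And>x. w' x = w x + c * conv w' w x"
    and f: "causal f" and u: "causal u" and eq: "\<And>x. f x = u x + c * conv w f x"
  shows "f x = u x + c * conv w' u x"
proof -
  have f_eq: "f = (\<lambda>x. u x + c * conv w f x)" and w'_eq: "w' = (\<lambda>x. w x + c * conv w' w x)"
    using eq res by blast+
  have "conv w' f = conv w' (\<lambda>x. u x + c * conv w f x)" using f_eq by simp
  then have 1: "conv w' f = (\<lambda>x. conv w' u x + c * conv w' (conv w f) x)"
    using w u f by (simp add: conv_add_right causal_cmult conv_cmult_right causal_conv)
  have "conv w' f = conv (\<lambda>x. w x + c * conv w' w x) f" using w'_eq by simp
  also have "\<dots> = (\<lambda>x. conv w f x + c * conv (conv w' w) f x)"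
    using w f by (simp add: conv_add_left causal_cmult conv_cmult_left causal_conv)
  finally have "conv w' f x = conv w f x + c * conv w' (conv w f) x" using conv_assoc[OF w(2,1) f] by simp
  then have "conv w f x = conv w' u x" using 1 by simp
  then show ?thesis using eq by simp
qed

text \<open>Stated for a general source \<open>u\<close>, so that both formulas are instances:
  \<open>u\<close> is \<open>W 0\<close> in one case and the indicator of \<open>{0..}\<close> in
  the other.\<close>

lemma omega_scale_core:
  assumes w: "causal w0" "causal wp" "causal wpq"
    and res1: "\<And>x. wp x = w0 x + p * conv wp w0 x"
    and res2: "\<And>x. wpq x = wp x + q * conv wpq wp x"
    and f: "causal f" and u: "causal u" and "a < b"
    and eq: "\<And>x. f x = u x + conv w0 (\<lambda>y. (p + q * indicator {a<..<b} y) * f y) x"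
    and v: "\<And>x. v x = u x + p * conv wp u x"
    and A: "\<And>x. A x = v x + q * conv wpq (\<lambda>y. indicator {a..} y * v y) x"
  shows "f x = A x - q * conv wp (\<lambda>y. indicator {b..} y * A y) x"
proof -
  let ?a = "indicator {a..} :: real \<Rightarrow> real" and ?b = "indicator {b..} :: real \<Rightarrow> real"
    and ?ab = "indicator {a<..<b} :: real \<Rightarrow> real"
  have cv: "causal v" unfolding ext[of v, OF v] by (intro causal_add causal_cmult causal_conv w u)
  have cA: "causal A" unfolding ext[of A, OF A]
    by (intro causal_add causal_cmult causal_conv w cv causal_indicator_mult) auto
  \<comment> \<open>\<open>{a..}\<close> is the disjoint union of \<open>{a}\<close>,
    \<open>{a<..<b}\<close> and \<open>{b..}\<close>, and the point \<open>a\<close> is a null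
    set.\<close>
  have split: "conv wp (\<lambda>y. ?a y * k y) x = conv wp (\<lambda>y. ?ab y * k y) x + conv wp (\<lambda>y. ?b y * k y) x"
    if k: "causal k" for k x
  proof -
    have "conv wp (\<lambda>y. ?a y * k y) = conv wp (\<lambda>y. ?ab y * k y + ?b y * k y)"
    proof (rule conv_cong_AE)
      show "AE y in lborel. ?a y * k y = ?ab y * k y + ?b y * k y"
        using AE_lborel_singleton[of a] by (rule AE_mp) (use \<open>a < b\<close> in \<open>auto simp: indicator_def intro!: AE_I2\<close>)
      show "causal (\<lambda>y. ?a y * k y)" by (rule causal_indicator_mult[OF k]) simp
      show "causal (\<lambda>y. ?ab y * k y + ?b y * k y)"
        by (rule causal_add; rule causal_indicator_mult[OF k]) simp_all
    qed (rule w)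
    then show ?thesis using k w by (simp add: conv_add_right causal_indicator_mult)
  qed
  \<comment> \<open>The part of the weight beyond the constant \<open>p\<close> is moved into the
    source, leaving an equation with constant rate \<open>p\<close>.\<close>
  define g where "g y = q * (?ab y * f y)" for y
  have cg: "causal g" unfolding g_def by (intro causal_cmult causal_indicator_mult f) auto
  have f0: "f x = (u x + conv w0 g x) + p * conv w0 f x" for x
  proof -
    have "(\<lambda>y. (p + q * ?ab y) * f y) = (\<lambda>y. p * f y + g y)" by (auto simp: g_def algebra_simps)
    then show ?thesis using eq[of x] w f cg
      by (simp add: conv_add_right causal_cmult conv_cmult_right)
  qed
  have wp: "wp = (\<lambda>x. w0 x + p * conv wp w0 x)" using res1 by blast
  have fp: "f x = v x + q * conv wp (\<lambda>y. ?ab y * f y) x" for x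
  proof -
    have cc: "causal (conv w0 g)" by (intro causal_conv w cg)
    have "f x = (u x + conv w0 g x) + p * conv wp (\<lambda>x. u x + conv w0 g x) x"
      by (rule resolvent_solve[OF w(1,2) res1 f _ f0]) (intro causal_add u cc)
    also have "\<dots> = v x + (conv w0 g x + p * conv (conv wp w0) g x)"
      using w u cc cg by (simp add: conv_add_right v conv_assoc algebra_simps)
    \<comment> \<open>The first resolvent identity convolved with \<open>g\<close>.\<close>
    also have "conv w0 g x + p * conv (conv wp w0) g x = conv wp g x"
      using w cg by (subst (2) wp) (simp add: conv_add_left causal_cmult conv_cmult_left causal_conv)
    also have "conv wp g x = q * conv wp (\<lambda>y. ?ab y * f y) x" unfolding g_def conv_cmult_right ..
    finally show ?thesis .
  qed
  have Ap: "A x = v x + q * conv wp (\<lambda>y. ?a y * A y) x" for x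
  proof -
    have conv_a: "conv wpq (\<lambda>y. ?a y * v y) x = 0" if "x < a" for x
    proof -
      have "conv wpq (\<lambda>y. ?a y * v y) x = conv wpq (\<lambda>y. 0) x"
        by (rule conv_cong_below[OF w(3)]) (use that in auto)
      then show ?thesis by (simp add: conv_def)
    qed
    \<comment> \<open>The definition of \<open>A\<close> solved for \<open>v\<close> and cut to
      \<open>{a..}\<close>; the convolution needs no cut because it already vanishes to the left of
      \<open>a\<close>.\<close>
    have e: "?a x * v x = ?a x * A x + (- q) * conv wpq (\<lambda>y. ?a y * v y) x" for x
      using A[of x] conv_a[of x] by (auto simp: indicator_def)
    \<comment> \<open>The second resolvent identity read backwards, from rate \<open>p + q\<close>
      down to \<open>p\<close>, hence the constant \<open>- q\<close>.\<close>
    have r: "wp x = wpq x + (- q) * conv wp wpq x" for x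
      using res2[of x] by (simp add: conv_commute[of wp wpq])
    have "?a x * v x = ?a x * A x + (- q) * conv wp (\<lambda>y. ?a y * A y) x"
      by (rule resolvent_solve[OF w(3,2) r _ _ e]) (intro causal_indicator_mult cv cA, simp)+
    then show ?thesis using A[of x] e[of x] by simp
  qed
  have fA: "f x = A x" if "a \<le> x" "x < b" for x
  proof -
    \<comment> \<open>The contribution of \<open>f\<close> on \<open>{b..}\<close> is absorbed into
      the source. The function \<open>f\<close> cut to \<open>{a..}\<close> then solves an equation
      with kernel \<open>wp\<close>, and to the left of \<open>b\<close> the source \<open>k\<close>
      is just \<open>v\<close> cut to \<open>{a..}\<close>.\<close>
    define k where "k y = ?a y * (v y + (- q) * conv wp (\<lambda>y. ?b y * f y) y)" for y
    have ck: "causal k" unfolding k_def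
      by (intro causal_indicator_mult causal_add cv causal_cmult causal_conv w f) auto
    have conv_a: "conv wp (\<lambda>y. ?a y * f y) x = 0" if "x < a" for x
    proof -
      have "conv wp (\<lambda>y. ?a y * f y) x = conv wp (\<lambda>y. 0) x"
        by (rule conv_cong_below[OF w(2)]) (use that in auto)
      then show ?thesis by (simp add: conv_def)
    qed
    have k_v: "k y = ?a y * v y" if "y < b" for y
    proof -
      have "conv wp (\<lambda>y. ?b y * f y) y = conv wp (\<lambda>y. 0) y"
        by (rule conv_cong_below[OF w(2)]) (use that in auto)
      then show ?thesis by (simp add: conv_def k_def)
    qed
    have e: "?a x * f x = k x + q * conv wp (\<lambda>y. ?a y * f y) x" for x
    proof (cases "x < a")
      case True
      then show ?thesis using conv_a by (simp add: k_def)
    next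
      case False
      then have "?a x = 1" by simp
      then show ?thesis unfolding k_def using fp[of x] split[OF f, of x] by (simp add: algebra_simps)
    qed
    have "?a x * f x = k x + q * conv wpq k x"
      by (rule resolvent_solve[OF w(2,3) res2 _ ck e]) (intro causal_indicator_mult f, simp)
    \<comment> \<open>As \<open>x < b\<close>, only values of \<open>k\<close> to the left of
      \<open>b\<close> enter.\<close>
    also have "conv wpq k x = conv wpq (\<lambda>y. ?a y * v y) x"
      by (rule conv_cong_below[OF w(3)]) (use k_v that in auto)
    finally show ?thesis using that k_v[of x] A[of x] by simp
  qed
  \<comment> \<open>On \<open>{a<..<b}\<close> the unknown \<open>f\<close> may be replaced by
    \<open>A\<close>; subtracting \<open>Ap\<close> then leaves only the part on
    \<open>{b..}\<close>.\<close>
  have "(\<lambda>y. ?ab y * f y) = (\<lambda>y. ?ab y * A y)" using fA by (auto simp: indicator_def)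
  then have "f x = v x + q * conv wp (\<lambda>y. ?ab y * A y) x" using fp[of x] by simp
  then show ?thesis using Ap[of x] split[OF cA, of x] by (simp add: algebra_simps)
qed

section \<open>Truncation to the half-line and the two formulas\<close>

text \<open>Needed because \<open>Z\<omega>\<close> equals 1 on the negative axis and becomes causal
  only after truncation.\<close>

lemma locally_bounded_causal:
  assumes "f \<in> borel_measurable borel" "locally_bounded f"
  shows "causal (\<lambda>x. indicator {0..} x * f x)"
proof (rule causalI)
  fix b :: real
  have "bounded (f ` {0..b})" using assms(2) by (simp add: locally_bounded_def)
  then obtain C where "\<forall>x\<in>{0..b}. \<bar>f x\<bar> \<le> C" by (auto simp: bounded_iff)
  then show "\<exists>C. \<forall>x\<in>{0..b}. \<bar>indicator {0..} x * f x\<bar> \<le> C"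
    by (intro exI[of _ C]) auto
qed (use assms in auto)

theorem mainTheorem8:
  fixes M :: "'a measure" and X :: "real \<Rightarrow> 'a \<Rightarrow> real"
    and \<psi> :: "real \<Rightarrow> real" and W :: "real \<Rightarrow> real \<Rightarrow> real"
    and \<omega> W\<omega> Z\<omega> :: "real \<Rightarrow> real" and p q a b :: real
  assumes "spectrally_negative_levy M X"
    and "laplace_exponent M X \<psi>"
    and "\<And>r. r \<ge> 0 \<Longrightarrow> scale_function \<psi> r (W r)"
    and "p > 0" and "q > 0" and "0 < a" and "a < b"
    and "\<And>x. \<omega> x = p + q * indicator {a<..<b} x"
    and "omega_W_scale W \<omega> W\<omega>"
    and "omega_Z_scale W \<omega> Z\<omega>"
  shows "\<forall>x\<ge>0.
      W\<omega> x = W_pq W a p q x - q * (LINT z:{b..x}|lborel. W p (x - z) * W_pq W a p q z) \<and>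
      Z\<omega> x = Z_pq W a p q x - q * (LINT z:{b..x}|lborel. W p (x - z) * Z_pq W a p q z)"
proof (intro allI impI)
  fix x :: real assume x: "x \<ge> 0"
  have c: "causal (W 0)" "causal (W p)" "causal (W (p + q))"
    using assms(3-5) by (auto intro!: scale_function_causal[OF assms(3)])
  have r1: "W p x = W 0 x + p * conv (W p) (W 0) x" for x
    using scale_function_resolvent[OF assms(3), of 0 p x] assms(4) by simp
  have r2: "W (p + q) x = W p x + q * conv (W (p + q)) (W p) x" for x
    using scale_function_resolvent[OF assms(3), of p "p + q" x] assms(4,5) by simp
  note core = omega_scale_core[OF c r1 r2 _ _ \<open>a < b\<close>]
  let ?H = "indicator {0..} :: real \<Rightarrow> real"
  \<comment> \<open>Common to both formulas: all functions are multiplied by \<open>?H\<close>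
    before \<open>core\<close> is applied. Since \<open>0 < a < b\<close>, the truncation changes
    nothing under the indicators of \<open>{a..}\<close> and \<open>{b..}\<close>.\<close>
  have solution: "f x = A x - q * (LINT z:{b..x}|lborel. W p (x - z) * A z)"
    if f: "f \<in> borel_measurable borel" "locally_bounded f"
      and u: "causal (\<lambda>x. ?H x * u x)"
      and eq: "\<And>x. f x = u x + (LINT y:{0..x}|lborel. W 0 (x - y) * \<omega> y * f y)"
      and v: "\<And>x. x \<ge> 0 \<Longrightarrow> v x = u x + p * conv (W p) (\<lambda>y. ?H y * u y) x"
      and A: "\<And>x. A x = v x + q * (LINT y:{a..x}|lborel. W (p + q) (x - y) * v y)"
    for f u v A
  proof -
    have H0: "?H x * A x = ?H x * v x + q * conv (W (p + q)) (\<lambda>y. indicator {a..} y * (?H y * v y)) x" for x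
    proof -
      have "(\<lambda>y. indicator {a..} y * (?H y * v y)) = (\<lambda>y. indicator {a..} y * v y)"
        using \<open>0 < a\<close> by (auto simp: indicator_def)
      then have "q * conv (W (p + q)) (\<lambda>y. indicator {a..} y * (?H y * v y)) x
          = q * (LINT y:{a..x}|lborel. W (p + q) (x - y) * v y)"
        using set_lebesgue_integral_eq_conv[OF c(3)] by simp
      then show ?thesis using A[of x] \<open>0 < a\<close> by (cases "x < 0") (auto simp: set_lebesgue_integral_def)
    qed
    have cf: "causal (\<lambda>x. ?H x * f x)" by (rule locally_bounded_causal[OF f])
    have "?H x * f x = ?H x * A x - q * conv (W p) (\<lambda>y. indicator {b..} y * (?H y * A y)) x"
    proof (rule core[OF cf u _ _ H0])
      show "?H x * f x = ?H x * u x + conv (W 0) (\<lambda>y. (p + q * indicator {a<..<b} y) * (?H y * f y)) x" for x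
      proof -
        have "(\<lambda>y. (p + q * indicator {a<..<b} y) * (?H y * f y)) = (\<lambda>y. ?H y * (\<omega> y * f y))"
          using assms(8) by (auto simp: fun_eq_iff)
        then have "conv (W 0) (\<lambda>y. (p + q * indicator {a<..<b} y) * (?H y * f y)) x
            = (LINT y:{0..x}|lborel. W 0 (x - y) * \<omega> y * f y)"
          using set_lebesgue_integral_eq_conv[OF c(1), of 0 x "\<lambda>y. \<omega> y * f y"] by (simp add: mult.assoc)
        then show ?thesis using eq[of x] by (cases "x < 0") (auto simp: set_lebesgue_integral_def)
      qed
      show "?H x * v x = ?H x * u x + p * conv (W p) (\<lambda>y. ?H y * u y) x" for x
        using v[of x] conv_neg[OF c(2) u, of x] by (auto simp: indicator_def)
    qed
    moreover have "(\<lambda>y. indicator {b..} y * (?H y * A y)) = (\<lambda>y. indicator {b..} y * A y)"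
      using \<open>0 < a\<close> \<open>a < b\<close> by (auto simp: indicator_def)
    ultimately show ?thesis using x set_lebesgue_integral_eq_conv[OF c(2)] by simp
  qed
  show "W\<omega> x = W_pq W a p q x - q * (LINT z:{b..x}|lborel. W p (x - z) * W_pq W a p q z) \<and>
      Z\<omega> x = Z_pq W a p q x - q * (LINT z:{b..x}|lborel. W p (x - z) * Z_pq W a p q z)"
  proof
    have H: "(\<lambda>x. ?H x * W 0 x) = W 0" using causal_neg[OF c(1)] by (auto simp: indicator_def fun_eq_iff)
    show "W\<omega> x = W_pq W a p q x - q * (LINT z:{b..x}|lborel. W p (x - z) * W_pq W a p q z)"
    proof (rule solution[where u = "W 0" and v = "W p"])
      show "causal (\<lambda>x. ?H x * W 0 x)" unfolding H by (rule c(1))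
      show "W p x = W 0 x + p * conv (W p) (\<lambda>y. ?H y * W 0 y) x" for x unfolding H by (rule r1)
      show "W_pq W a p q x = W p x + q * (LINT y:{a..x}|lborel. W (p + q) (x - y) * W p y)" for x
        by (rule W_pq_def)
    qed (use assms(9) in \<open>unfold omega_W_scale_def, blast+\<close>)
    have cH: "causal (\<lambda>x. ?H x * 1)" by (rule locally_bounded_causal) (auto simp: locally_bounded_def image_constant_conv)
    \<comment> \<open>\<open>Z_scale W p\<close> arises from the constant source 1 just as
      \<open>W p\<close> arises from \<open>W 0\<close>, with convolution against \<open>?H\<close>
      in the role of integration from 0.\<close>
    have Z: "Z_scale W p x = 1 + p * conv (W p) (\<lambda>y. ?H y * 1) x" for x
    proof -
      \<comment> \<open>Inserting \<open>?H\<close> in front of \<open>W p\<close> creates the lower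
        limit 0 of the integral.\<close>
      have "conv (\<lambda>y. ?H y * 1) (W p) x = conv (\<lambda>y. ?H y * 1) (\<lambda>y. ?H y * W p y) x"
        using causal_neg[OF c(2)] by (intro conv_cong_below cH) (auto simp: indicator_def)
      also have "\<dots> = (LINT y:{0..x}|lborel. ?H (x - y) * 1 * W p y)"
        by (rule set_lebesgue_integral_eq_conv[OF cH, symmetric])
      also have "\<dots> = (LINT y:{0..x}|lborel. W p y)"
        by (rule set_lebesgue_integral_cong) (auto simp: indicator_def)
      finally show ?thesis by (simp add: Z_scale_def conv_commute[of "W p"])
    qed
    show "Z\<omega> x = Z_pq W a p q x - q * (LINT z:{b..x}|lborel. W p (x - z) * Z_pq W a p q z)"
    proof (rule solution[OF _ _ cH _ Z])
      show "Z_pq W a p q x = Z_scale W p x + q * (LINT y:{a..x}|lborel. W (p + q) (x - y) * Z_scale W p y)" for x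
        by (rule Z_pq_def)
    qed (use assms(10) in \<open>unfold omega_Z_scale_def, blast+\<close>)
  qed
qed

end
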